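(* Let $p\in(0,1)$, $f\colon\{0,1\}^n\to\mathbb{R}$ and $0\le\rho\le 1/\sqrt{12}$. Then \[\|\mathrm{T}_\rho f\|_4^4\le\sum_{S\subseteq[n]}(3\lambda\rho^4)^{|S|}\|\mathrm{D}_Sf\|_2^4\le\sum_{S\subseteq[n]}(3\sigma^2\rho^4)^{|S|}\mathrm{I}_S(f)^2,\] with norms and $\mathrm{T}_\rho$ taken with respect to $\mu_p$.
   Context: $\mu_p$ is the $p$-biased product measure on $\{0,1\}^n$. $\sigma=\sqrt{p(1-p)}$, $\chi_i(x)=(x_i-p)/\sigma$, $\chi_S=\prod_{i\in S}\chi_i$ (orthonormal basis of $L^2(\mu_p)$), $f=\sum_S\hat f(S)\chi_S$. $\mathrm{D}_Sf=\sum_{T\supseteq S}\hat f(T)\chi_{T\setminus S}$ and $\mathrm{I}_S(f)=\sigma^{-2|S|}\|\mathrm{D}_Sf\|_2^2=\sigma^{-2|S|}\sum_{T\supseteq S}\hat f(T)^2$. $\lambda=\mathbb{E}_{\mu_p}[\chi_i^4]=\sigma^{-2}((1-p)^3+p^3)$. The noise operator satisfies $\mathrm{T}_\rho\chi_S=\rho^{|S|}\chi_S$ (equivalently $\mathrm{T}_\rho f(x)=\mathbb{E}f(\mathbf{y})$ where each $\mathbf{y}_i=x_i$ with probability $\rho$, otherwise resampled from the $p$-biased bit). *)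

theory Defs
  imports "HOL-Probability.Probability"
begin

text \<open>
  A point of the cube \<open>{0,1}\<^sup>I\<close> (for a finite index set \<open>I\<close>) is a function \<open>x :: 'a \<Rightarrow> bool\<close>
  with \<open>x i = False\<close> outside \<open>I\<close>; \<open>True\<close> and \<open>False\<close> stand for 1 and 0. All averages are taken
  with respect to \<open>cube_pmf I p\<close>, which is supported on these points, so the values of a
  function elsewhere play no role.
\<close>

definition cube_pmf :: "'a set \<Rightarrow> real \<Rightarrow> ('a \<Rightarrow> bool) pmf" where
  "cube_pmf I p = Pi_pmf I False (\<lambda>_. bernoulli_pmf p)"

definition bias_sd :: "real \<Rightarrow> real" where
  "bias_sd p = sqrt (p * (1 - p))"

definition bit_char :: "real \<Rightarrow> bool \<Rightarrow> real" where
  "bit_char p b = (of_bool b - p) / bias_sd p"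

definition char_fun :: "real \<Rightarrow> 'a set \<Rightarrow> ('a \<Rightarrow> bool) \<Rightarrow> real" where
  "char_fun p S x = (\<Prod>i\<in>S. bit_char p (x i))"

definition fourier_coeff :: "'a set \<Rightarrow> real \<Rightarrow> (('a \<Rightarrow> bool) \<Rightarrow> real) \<Rightarrow> 'a set \<Rightarrow> real" where
  "fourier_coeff I p f S = measure_pmf.expectation (cube_pmf I p) (\<lambda>x. f x * char_fun p S x)"

definition Lnorm :: "'a set \<Rightarrow> real \<Rightarrow> real \<Rightarrow> (('a \<Rightarrow> bool) \<Rightarrow> real) \<Rightarrow> real" where
  "Lnorm I p q f = (measure_pmf.expectation (cube_pmf I p) (\<lambda>x. \<bar>f x\<bar> powr q)) powr (1 / q)"

definition deriv_op ::
    "'a set \<Rightarrow> real \<Rightarrow> 'a set \<Rightarrow> (('a \<Rightarrow> bool) \<Rightarrow> real) \<Rightarrow> ('a \<Rightarrow> bool) \<Rightarrow> real" where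
  "deriv_op I p S f x =
     (\<Sum>T | S \<subseteq> T \<and> T \<subseteq> I. fourier_coeff I p f T * char_fun p (T - S) x)"

definition gen_influence :: "'a set \<Rightarrow> real \<Rightarrow> 'a set \<Rightarrow> (('a \<Rightarrow> bool) \<Rightarrow> real) \<Rightarrow> real" where
  "gen_influence I p S f = (Lnorm I p 2 (deriv_op I p S f))\<^sup>2 / bias_sd p ^ (2 * card S)"

text \<open>The linear operator determined by \<open>\<chi>\<^sub>S \<mapsto> \<rho>\<^bsup>|S|\<^esup> \<chi>\<^sub>S\<close>; see \<open>noise_op_resample\<close> below for
  its description by resampling.\<close>

definition noise_op ::
    "'a set \<Rightarrow> real \<Rightarrow> real \<Rightarrow> (('a \<Rightarrow> bool) \<Rightarrow> real) \<Rightarrow> ('a \<Rightarrow> bool) \<Rightarrow> real" where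
  "noise_op I p \<rho> f x = (\<Sum>S\<in>Pow I. \<rho> ^ card S * fourier_coeff I p f S * char_fun p S x)"

text \<open>The fourth moment of a single character \<open>\<chi>\<^sub>i\<close>, whose law does not depend on \<open>i\<close>.\<close>

definition fourth_moment :: "real \<Rightarrow> real" where
  "fourth_moment p = measure_pmf.expectation (bernoulli_pmf p) (\<lambda>b. bit_char p b ^ 4)"

lemma fourth_moment_eq:
  assumes "0 < p" "p < 1"
  shows "fourth_moment p = ((1 - p) ^ 3 + p ^ 3) / (bias_sd p)\<^sup>2"
proof -
  define q where "q = 1 - p"
  have q: "q > 0" using assms by (simp add: q_def)
  have s: "(bias_sd p)\<^sup>2 = p * q" using assms by (simp add: bias_sd_def q_def)
  have s4: "bias_sd p ^ 4 = (p * q)\<^sup>2"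
    using arg_cong[OF s, of "\<lambda>t. t\<^sup>2"] by (simp flip: power_mult)
  have "fourth_moment p = q ^ 4 / (p * q)\<^sup>2 * p + p ^ 4 / (p * q)\<^sup>2 * q"
    using assms by (simp add: fourth_moment_def bit_char_def power_divide s4 q_def add_divide_distrib)
  also have "\<dots> = (q ^ 3 + p ^ 3) / (p * q)"
    using assms(1) q by (simp add: field_simps power_numeral_reduce)
  finally show ?thesis by (simp add: s q_def)
qed

lemma expectation_Pi_pmf_bool:
  fixes g :: "('a \<Rightarrow> bool) \<Rightarrow> real"
  assumes "finite I"
  shows "measure_pmf.expectation (Pi_pmf I False q) g
    = (\<Sum>y\<in>PiE_dflt I False (\<lambda>_. UNIV). g y * (\<Prod>i\<in>I. pmf (q i) (y i)))"
proof -
  have fin: "finite (PiE_dflt I False (\<lambda>_. UNIV :: bool set))"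
    using assms by auto
  have "measure_pmf.expectation (Pi_pmf I False q) g
    = (\<Sum>y\<in>PiE_dflt I False (\<lambda>_. UNIV). g y * pmf (Pi_pmf I False q) y)"
    using set_Pi_pmf_subset'[OF assms, of False q] fin
    by (intro integral_measure_pmf_real) (auto simp: PiE_dflt_def)
  also have "\<dots> = (\<Sum>y\<in>PiE_dflt I False (\<lambda>_. UNIV). g y * (\<Prod>i\<in>I. pmf (q i) (y i)))"
    by (intro sum.cong refl arg_cong2[of _ _ _ _ "(*)"] pmf_Pi' assms) (auto simp: PiE_dflt_def)
  finally show ?thesis .
qed

lemma expectation_prod_Pi_pmf_bool:
  fixes g :: "'a \<Rightarrow> bool \<Rightarrow> real"
  assumes "finite I"
  shows "measure_pmf.expectation (Pi_pmf I False q) (\<lambda>y. \<Prod>i\<in>I. g i (y i))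
    = (\<Prod>i\<in>I. measure_pmf.expectation (q i) (g i))"
proof -
  have "(\<Prod>i\<in>I. measure_pmf.expectation (q i) (g i))
      = (\<Prod>i\<in>I. \<Sum>b\<in>UNIV. g i b * pmf (q i) b)"
    by (intro prod.cong refl integral_measure_pmf_real) auto
  also have "\<dots> = (\<Sum>y\<in>PiE I (\<lambda>_. UNIV). \<Prod>i\<in>I. g i (y i) * pmf (q i) (y i))"
    by (rule prod_sum_PiE) (use assms in auto)
  also have "\<dots> = (\<Sum>y\<in>PiE_dflt I False (\<lambda>_. UNIV). \<Prod>i\<in>I. g i (y i) * pmf (q i) (y i))"
    by (rule sum.reindex_bij_witness[where j = "\<lambda>h x. if x \<in> I then h x else False"
          and i = "\<lambda>h. restrict h I"])
       (auto simp: PiE_dflt_def fun_eq_iff PiE_def extensional_def)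
  finally show ?thesis
    by (simp add: expectation_Pi_pmf_bool[OF assms] prod.distrib)
qed

lemma char_fun_extend:
  assumes "finite I" "S \<subseteq> I"
  shows "char_fun p S x = (\<Prod>i\<in>I. if i \<in> S then bit_char p (x i) else 1)"
  unfolding char_fun_def using assms
  by (simp add: prod.If_cases Int_absorb1)

lemma fourier_expansion:
  assumes I: "finite I" and p: "0 < p" "p < 1" and x: "\<And>i. i \<notin> I \<Longrightarrow> \<not> x i"
  shows "f x = (\<Sum>S\<in>Pow I. fourier_coeff I p f S * char_fun p S x)"
proof -
  let ?X = "PiE_dflt I False (\<lambda>_. UNIV :: bool set)"
  let ?w = "\<lambda>y. \<Prod>i\<in>I. pmf (bernoulli_pmf p) (y i)"
  have fin: "finite ?X" using I by auto
  have xX: "x \<in> ?X" using x by (auto simp: PiE_dflt_def)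
  have s: "bias_sd p * bias_sd p = p * (1 - p)" using p by (simp add: bias_sd_def)
  have bit: "(1 + bit_char p b * bit_char p c) * pmf (bernoulli_pmf p) b = of_bool (b = c)" for b c
    using p by (cases b; cases c) (simp_all add: bit_char_def s field_simps)
  have kernel: "(\<Sum>S\<in>Pow I. char_fun p S y * char_fun p S x) * ?w y = of_bool (y = x)"
    if y: "y \<in> ?X" for y
  proof -
    have "(\<Sum>S\<in>Pow I. char_fun p S y * char_fun p S x)
        = (\<Prod>i\<in>I. bit_char p (y i) * bit_char p (x i) + 1)"
      by (subst prod_add[OF I]) (simp add: char_fun_def prod.distrib)
    then have "(\<Sum>S\<in>Pow I. char_fun p S y * char_fun p S x) * ?w y
        = (\<Prod>i\<in>I. (1 + bit_char p (y i) * bit_char p (x i)) * pmf (bernoulli_pmf p) (y i))"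
      by (simp only: prod.distrib add.commute)
    also have "\<dots> = (\<Prod>i\<in>I. of_bool (y i = x i))" by (simp only: bit)
    also have "\<dots> = of_bool (\<forall>i\<in>I. y i = x i)"
      using I by (induction I rule: finite_induct) auto
    also have "(\<forall>i\<in>I. y i = x i) \<longleftrightarrow> y = x"
      using y x by (auto simp: PiE_dflt_def fun_eq_iff)
    finally show ?thesis .
  qed
  have "(\<Sum>S\<in>Pow I. fourier_coeff I p f S * char_fun p S x)
      = (\<Sum>S\<in>Pow I. \<Sum>y\<in>?X. f y * ((char_fun p S y * char_fun p S x) * ?w y))"
    by (simp add: fourier_coeff_def cube_pmf_def expectation_Pi_pmf_bool[OF I]
        sum_distrib_right sum_distrib_left mult_ac)
  also have "\<dots> = (\<Sum>y\<in>?X. f y * ((\<Sum>S\<in>Pow I. char_fun p S y * char_fun p S x) * ?w y))"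
    by (subst sum.swap) (simp only: sum_distrib_left sum_distrib_right)
  also have "\<dots> = (\<Sum>y\<in>?X. f y * of_bool (y = x))"
    by (intro sum.cong refl) (simp only: kernel)
  also have "\<dots> = (\<Sum>y\<in>?X. if y = x then f y else 0)"
    by (intro sum.cong) auto
  also have "\<dots> = f x" using fin xX by simp
  finally show ?thesis by simp
qed

lemma noise_op_resample:
  assumes I: "finite I" and p: "0 < p" "p < 1" and \<rho>: "0 \<le> \<rho>" "\<rho> \<le> 1"
  shows "noise_op I p \<rho> f x = measure_pmf.expectation
    (Pi_pmf I False (\<lambda>i. bernoulli_pmf \<rho> \<bind> (\<lambda>k. if k then return_pmf (x i) else bernoulli_pmf p))) f"
    (is "_ = measure_pmf.expectation (Pi_pmf I False ?q) f")
proof -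
  let ?X = "PiE_dflt I False (\<lambda>_. UNIV :: bool set)"
  have bit: "measure_pmf.expectation (?q i) (bit_char p) = \<rho> * bit_char p (x i)" for i
  proof -
    have "measure_pmf.expectation (?q i) (bit_char p)
        = (\<Sum>b\<in>UNIV. bit_char p b * pmf (?q i) b)"
      by (intro integral_measure_pmf_real) auto
    also have "\<dots> = \<rho> * bit_char p (x i)"
      using p \<rho> by (cases "x i")
        (simp_all add: UNIV_bool pmf_bind bit_char_def divide_simps, simp_all add: algebra_simps)
    finally show ?thesis .
  qed
  have char: "measure_pmf.expectation (Pi_pmf I False ?q) (char_fun p S) = \<rho> ^ card S * char_fun p S x"
    if S: "S \<subseteq> I" for S
  proof -
    have "measure_pmf.expectation (Pi_pmf I False ?q) (char_fun p S)
        = measure_pmf.expectation (Pi_pmf I False ?q)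
            (\<lambda>y. \<Prod>i\<in>I. (if i \<in> S then bit_char p else (\<lambda>_. 1)) (y i))"
      by (intro arg_cong[of _ _ "measure_pmf.expectation _"])
         (auto simp: fun_eq_iff char_fun_extend[OF I S] intro!: prod.cong)
    also have "\<dots> = (\<Prod>i\<in>I. measure_pmf.expectation (?q i) (if i \<in> S then bit_char p else (\<lambda>_. 1)))"
      by (rule expectation_prod_Pi_pmf_bool[OF I])
    also have "\<dots> = (\<Prod>i\<in>I. if i \<in> S then \<rho> * bit_char p (x i) else 1)"
      by (intro prod.cong refl) (auto simp: bit)
    also have "\<dots> = (\<Prod>i\<in>S. \<rho> * bit_char p (x i))"
      using I S by (simp add: prod.If_cases Int_absorb1)
    finally show ?thesis by (simp add: prod.distrib char_fun_def)
  qed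
  have "measure_pmf.expectation (Pi_pmf I False ?q) f
      = (\<Sum>y\<in>?X. (\<Sum>S\<in>Pow I. fourier_coeff I p f S * char_fun p S y) * (\<Prod>i\<in>I. pmf (?q i) (y i)))"
    unfolding expectation_Pi_pmf_bool[OF I]
    by (intro sum.cong refl arg_cong2[of _ _ _ _ "(*)"] fourier_expansion I p)
       (auto simp: PiE_dflt_def)
  also have "\<dots> = (\<Sum>S\<in>Pow I. fourier_coeff I p f S
      * (\<Sum>y\<in>?X. char_fun p S y * (\<Prod>i\<in>I. pmf (?q i) (y i))))"
    by (simp only: sum_distrib_right sum_distrib_left mult.assoc) (rule sum.swap)
  also have "\<dots> = (\<Sum>S\<in>Pow I. fourier_coeff I p f S * (\<rho> ^ card S * char_fun p S x))"
    by (intro sum.cong refl) (simp add: char flip: expectation_Pi_pmf_bool[OF I])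
  finally show ?thesis by (simp add: noise_op_def mult_ac)
qed

end

theory Submission
  imports Defs
begin

text \<open>
  The first inequality is polarised: for two functions \<open>g\<close> and \<open>h\<close>,
  \<open>E[(T g)\<^sup>2 (T h)\<^sup>2] \<le> \<Sum>\<^sub>S (3\<lambda>\<rho>\<^sup>4)\<^bsup>|S|\<^esup> \<parallel>D\<^sub>S g\<parallel>\<^sup>2 \<parallel>D\<^sub>S h\<parallel>\<^sup>2\<close>. In this form it survives induction on
  the number of coordinates. Writing \<open>g = g\<^sub>0 + \<chi>\<^sub>i g\<^sub>1\<close> and \<open>h = h\<^sub>0 + \<chi>\<^sub>i h\<^sub>1\<close>, averaging over
  coordinate \<open>i\<close> and removing the mixed terms by AM-GM (with \<open>E[\<chi>\<^sub>i\<^sup>3]\<^sup>2 \<le> \<lambda>\<close>) bounds the left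
  side by the four expectations for the pairs \<open>(g\<^sub>j, h\<^sub>k)\<close> with weights \<open>1\<close>, \<open>4\<rho>\<^sup>2\<close>, \<open>4\<rho>\<^sup>2\<close>,
  \<open>3\<lambda>\<rho>\<^sup>4\<close>, while \<open>\<parallel>D\<^sub>S g\<parallel>\<^sup>2\<close> equals \<open>\<parallel>D\<^sub>S g\<^sub>0\<parallel>\<^sup>2 + \<parallel>D\<^sub>S g\<^sub>1\<parallel>\<^sup>2\<close> if \<open>i \<notin> S\<close> and
  \<open>\<parallel>D\<^bsub>S - {i}\<^esub> g\<^sub>1\<parallel>\<^sup>2\<close> if \<open>i \<in> S\<close>.
\<close>

section \<open>Coefficient families and splitting off one coordinate\<close>

text \<open>The noise operator written for an arbitrary coefficient family \<open>a\<close>, so that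
  the induction can pass from \<open>a\<close> to \<open>\<lambda>T. a (insert i T)\<close> without
  naming the functions on the smaller cube.\<close>

definition noisy_poly ::
    "'a set \<Rightarrow> real \<Rightarrow> real \<Rightarrow> ('a set \<Rightarrow> real) \<Rightarrow> ('a \<Rightarrow> bool) \<Rightarrow> real" where
  "noisy_poly I p \<rho> a x = (\<Sum>S\<in>Pow I. \<rho> ^ card S * a S * char_fun p S x)"

text \<open>By Parseval this is the squared 2-norm of the derivative along \<open>S\<close> of the
  function with coefficients \<open>a\<close>; see \<open>Lnorm_deriv_op_squared\<close>.\<close>

definition upper_weight :: "'a set \<Rightarrow> ('a set \<Rightarrow> real) \<Rightarrow> 'a set \<Rightarrow> real" where
  "upper_weight I a S = (\<Sum>T | S \<subseteq> T \<and> T \<subseteq> I. (a T)\<^sup>2)"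

lemma upper_weight_nonneg: "0 \<le> upper_weight I a S"
  by (simp add: upper_weight_def sum_nonneg)

lemma sum_Pow_insert:
  fixes g :: "'a set \<Rightarrow> 'b::comm_monoid_add"
  assumes "finite I" "i \<notin> I"
  shows "(\<Sum>S\<in>Pow (insert i I). g S) = (\<Sum>S\<in>Pow I. g S) + (\<Sum>S\<in>Pow I. g (insert i S))"
proof -
  have "inj_on (insert i) (Pow I)"
    using assms(2) by (auto simp: inj_on_def)
  moreover have "Pow I \<inter> insert i ` Pow I = {}"
    using assms(2) by auto
  ultimately show ?thesis
    using assms(1) by (simp add: Pow_insert sum.union_disjoint sum.reindex)
qed

lemma upper_weight_eq_sum_Pow:
  assumes "finite I"
  shows "upper_weight I a S = (\<Sum>T\<in>Pow I. if S \<subseteq> T then (a T)\<^sup>2 else 0)"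
  unfolding upper_weight_def using assms
  by (intro sum.mono_neutral_cong_left) auto

lemma upper_weight_insert:
  assumes "finite I" "i \<notin> I" "S \<subseteq> I"
  shows "upper_weight (insert i I) a S
           = upper_weight I a S + upper_weight I (\<lambda>T. a (insert i T)) S"
    and "upper_weight (insert i I) a (insert i S) = upper_weight I (\<lambda>T. a (insert i T)) S"
proof -
  have 1: "S \<subseteq> insert i T \<longleftrightarrow> S \<subseteq> T" for T
    using assms(2,3) by blast
  have 2: "\<not> insert i S \<subseteq> T" if "T \<in> Pow I" for T
    using assms(2) that by blast
  show "upper_weight (insert i I) a S
      = upper_weight I a S + upper_weight I (\<lambda>T. a (insert i T)) S"
    using assms by (simp add: upper_weight_eq_sum_Pow sum_Pow_insert 1)
  have "(\<Sum>T\<in>Pow I. if insert i S \<subseteq> T then (a T)\<^sup>2 else 0) = 0"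
    using 2 by (intro sum.neutral) auto
  then show "upper_weight (insert i I) a (insert i S) = upper_weight I (\<lambda>T. a (insert i T)) S"
    using assms by (simp add: upper_weight_eq_sum_Pow sum_Pow_insert 1)
qed

lemma char_fun_upd: "i \<notin> S \<Longrightarrow> char_fun p S (x(i := b)) = char_fun p S x"
  by (auto simp: char_fun_def intro!: prod.cong)

text \<open>A subset of \<open>insert i I\<close> either avoids \<open>i\<close> or is some
  \<open>insert i S\<close>; the latter gains one factor \<rho> from its size and one factor
  \<open>bit_char p b\<close> from its character.\<close>

lemma noisy_poly_insert:
  assumes "finite I" "i \<notin> I"
  shows "noisy_poly (insert i I) p \<rho> a (x(i := b))
    = noisy_poly I p \<rho> a x + \<rho> * bit_char p b * noisy_poly I p \<rho> (\<lambda>T. a (insert i T)) x"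
proof -
  have 1: "\<rho> ^ card (insert i S) * a (insert i S) * char_fun p (insert i S) (x(i := b))
      = \<rho> * bit_char p b * (\<rho> ^ card S * a (insert i S) * char_fun p S x)" if "S \<in> Pow I" for S
  proof -
    have S: "finite S" "i \<notin> S"
      using that assms by (auto intro: finite_subset)
    then have "char_fun p (insert i S) (x(i := b)) = bit_char p b * char_fun p S (x(i := b))"
      unfolding char_fun_def by simp
    then show ?thesis
      using S by (simp add: char_fun_upd)
  qed
  have 2: "char_fun p S (x(i := b)) = char_fun p S x" if "S \<in> Pow I" for S
    using that assms by (intro char_fun_upd) auto
  show ?thesis
    unfolding noisy_poly_def sum_Pow_insert[OF assms] sum_distrib_left
    by (intro arg_cong2[of _ _ _ _ "(+)"] sum.cong refl 1) (simp_all only: 2)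
qed

section \<open>Averaging over the cube one coordinate at a time\<close>

lemma finite_set_cube_pmf:
  assumes "finite I"
  shows "finite (set_pmf (cube_pmf I p))"
proof -
  have "finite (PiE_dflt I False (\<lambda>_. UNIV :: bool set))"
    using assms by auto
  then show ?thesis
    unfolding cube_pmf_def
    by (rule finite_subset[rotated])
       (use set_Pi_pmf_subset'[OF assms, of False "\<lambda>_. bernoulli_pmf p"] in \<open>auto simp: PiE_dflt_def\<close>)
qed

lemma integrable_cube_pmf [simp]:
  fixes F :: "('a \<Rightarrow> bool) \<Rightarrow> real"
  shows "finite I \<Longrightarrow> integrable (measure_pmf (cube_pmf I p)) F"
  by (intro integrable_measure_pmf_finite finite_set_cube_pmf)

lemma expectation_cube_pmf_insert:
  fixes F :: "('a \<Rightarrow> bool) \<Rightarrow> real"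
  assumes "finite I" "i \<notin> I" "0 \<le> p" "p \<le> 1"
  shows "measure_pmf.expectation (cube_pmf (insert i I) p) F
    = measure_pmf.expectation (cube_pmf I p)
        (\<lambda>x. p * F (x(i := True)) + (1 - p) * F (x(i := False)))"
proof -
  have "cube_pmf (insert i I) p
      = bernoulli_pmf p \<bind> (\<lambda>b. map_pmf (\<lambda>x. x(i := b)) (cube_pmf I p))"
    using assms by (simp add: cube_pmf_def Pi_pmf_insert' map_pmf_def)
  also have "measure_pmf.expectation \<dots> F
      = (\<Sum>b\<in>UNIV. pmf (bernoulli_pmf p) b *\<^sub>R
          measure_pmf.expectation (map_pmf (\<lambda>x. x(i := b)) (cube_pmf I p)) F)"
    using assms(1) by (intro pmf_expectation_bind) (auto simp: finite_set_cube_pmf)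
  also have "\<dots> = p * measure_pmf.expectation (cube_pmf I p) (\<lambda>x. F (x(i := True)))
      + (1 - p) * measure_pmf.expectation (cube_pmf I p) (\<lambda>x. F (x(i := False)))"
    using assms(3,4) by (simp add: UNIV_bool del: fun_upd_apply)
  finally show ?thesis
    using assms(1) by simp
qed

section \<open>The one-coordinate inequality and the induction\<close>

text \<open>The difference of the two sides is a combination of squares with nonnegative
  coefficients. In use, \<open>u\<close>, \<open>u'\<close> are the noisy values of the two parts of
  the first function at a fixed point, and \<open>w\<close>, \<open>w'\<close> those of the
  second.\<close>

lemma bernoulli_fourth_moment_bound:
  fixes u u' w w' \<rho> :: real
  assumes p: "0 < p" "p < 1"
  shows "p * ((u + \<rho> * bit_char p True * u')\<^sup>2 * (w + \<rho> * bit_char p True * w')\<^sup>2)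
       + (1 - p) * ((u + \<rho> * bit_char p False * u')\<^sup>2 * (w + \<rho> * bit_char p False * w')\<^sup>2)
     \<le> u\<^sup>2 * w\<^sup>2 + 4 * \<rho>\<^sup>2 * (u\<^sup>2 * w'\<^sup>2 + u'\<^sup>2 * w\<^sup>2) + 3 * fourth_moment p * \<rho> ^ 4 * (u'\<^sup>2 * w'\<^sup>2)"
    (is "?L \<le> ?R")
proof -
  define t where "t = bit_char p True"
  define s where "s = bit_char p False"
  define q where "q = 1 - p"
  define m where "m = p * t ^ 3 + q * s ^ 3"
  define l where "l = p * t ^ 4 + q * s ^ 4"
  have pq: "p + q = 1" "0 < q" using p by (simp_all add: q_def)
  have sd: "bias_sd p > 0" "(bias_sd p)\<^sup>2 = p * q"
    using p by (simp_all add: bias_sd_def q_def)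
  have m1: "p * t + q * s = 0"
    by (simp add: t_def s_def q_def bit_char_def algebra_simps diff_divide_distrib)
  have "p * t\<^sup>2 + q * s\<^sup>2 = (p * q * (p + q)) / (p * q)"
    by (simp add: t_def s_def bit_char_def power_divide sd flip: q_def add_divide_distrib)
       (simp add: algebra_simps power2_eq_square)
  then have m2: "p * t\<^sup>2 + q * s\<^sup>2 = 1"
    using p pq by simp
  have l: "fourth_moment p = l"
    using p by (simp add: fourth_moment_def l_def t_def s_def q_def)
  \<comment> \<open>Lagrange's identity behind the Cauchy-Schwarz inequality for the character and
    its square: the third moment satisfies \<open>m^2 \<le> l\<close>.\<close>
  have "l - m\<^sup>2 = l * (p * t\<^sup>2 + q * s\<^sup>2) - m\<^sup>2"
    by (simp add: m2)
  also have "\<dots> = p * q * (t * s * (s - t))\<^sup>2"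
    unfolding l_def m_def by algebra
  finally have ml: "0 \<le> l - m\<^sup>2"
    using p pq by simp
  \<comment> \<open>Expansion in powers of the character, whose moments of order 0 to 4 are 1, 0, 1,
    \<open>m\<close>, \<open>l\<close>.\<close>
  have "?L = (p + q) * (u\<^sup>2 * w\<^sup>2)
      + (p * t + q * s) * (2 * \<rho> * u * w * (u * w' + u' * w))
      + (p * t\<^sup>2 + q * s\<^sup>2) * (\<rho>\<^sup>2 * (u\<^sup>2 * w'\<^sup>2 + u'\<^sup>2 * w\<^sup>2 + 4 * u * u' * w * w'))
      + m * (\<rho> ^ 3 * (2 * u * u' * w'\<^sup>2 + 2 * u'\<^sup>2 * w * w')) + l * (\<rho> ^ 4 * (u'\<^sup>2 * w'\<^sup>2))"
    unfolding m_def l_def by (fold t_def s_def q_def) algebra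
  \<comment> \<open>Completing squares explains the constants. The term with
    \<open>4 * u * u' * w * w'\<close> adds 2 to the coefficients of the mixed squares and the cubic
    terms add 1, so 1 + 2 + 1 = 4. Each of the two cubic terms also costs \<open>m^2\<close>, at
    most \<open>l\<close>, in the last coefficient, so 1 + 1 + 1 = 3.\<close>
  also have "\<dots> = ?R - 2 * \<rho>\<^sup>2 * (u * w' - u' * w)\<^sup>2
      - \<rho>\<^sup>2 * w'\<^sup>2 * ((u - \<rho> * m * u')\<^sup>2 + (l - m\<^sup>2) * (\<rho> * u')\<^sup>2)
      - \<rho>\<^sup>2 * u'\<^sup>2 * ((w - \<rho> * m * w')\<^sup>2 + (l - m\<^sup>2) * (\<rho> * w')\<^sup>2)"
    unfolding pq m1 m2 l by algebra
  also have "\<dots> \<le> ?R"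
    using ml by (smt (verit) mult_nonneg_nonneg zero_le_power2)
  finally show ?thesis .
qed

lemma noisy_poly_product_bound:
  fixes a b :: "'a set \<Rightarrow> real"
  assumes I: "finite I" and p: "0 < p" "p < 1" and \<rho>: "4 * \<rho>\<^sup>2 \<le> 1"
  shows "measure_pmf.expectation (cube_pmf I p)
           (\<lambda>x. (noisy_poly I p \<rho> a x)\<^sup>2 * (noisy_poly I p \<rho> b x)\<^sup>2)
    \<le> (\<Sum>S\<in>Pow I. (3 * fourth_moment p * \<rho> ^ 4) ^ card S
          * (upper_weight I a S * upper_weight I b S))"
  using I
proof (induction I arbitrary: a b rule: finite_induct)
  case empty
  have "{T. T = {} \<and> T \<subseteq> {}} = {{} :: 'a set}" by auto
  then show ?case
    by (simp add: noisy_poly_def upper_weight_def char_fun_def)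
next
  case (insert i I)
  note ins = insert.hyps
  define c where "c = 3 * fourth_moment p * \<rho> ^ 4"
  define a' where "a' = (\<lambda>T. a (insert i T))"
  define b' where "b' = (\<lambda>T. b (insert i T))"
  let ?E = "measure_pmf.expectation (cube_pmf I p)"
  let ?P = "noisy_poly I p \<rho>"
  let ?W = "upper_weight I"
  define Q where "Q = (\<lambda>g h. ?E (\<lambda>x. (?P g x)\<^sup>2 * (?P h x)\<^sup>2))"
  define R where "R = (\<lambda>g h. \<Sum>S\<in>Pow I. c ^ card S * (?W g S * ?W h S))"
  have Q0: "0 \<le> Q g h" for g h
    unfolding Q_def by (intro integral_nonneg_AE) auto
  have QR: "Q g h \<le> R g h" for g h
    using insert.IH unfolding Q_def R_def c_def .
  have c0: "0 \<le> c"
    by (simp add: c_def fourth_moment_def integral_nonneg_AE)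
  have card: "card (insert i S) = Suc (card S)" if "S \<in> Pow I" for S
    using that ins by (subst card_insert_disjoint) (auto intro: finite_subset)
  have "measure_pmf.expectation (cube_pmf (insert i I) p)
      (\<lambda>x. (noisy_poly (insert i I) p \<rho> a x)\<^sup>2 * (noisy_poly (insert i I) p \<rho> b x)\<^sup>2)
    \<le> ?E (\<lambda>x. (?P a x)\<^sup>2 * (?P b x)\<^sup>2
        + 4 * \<rho>\<^sup>2 * ((?P a x)\<^sup>2 * (?P b' x)\<^sup>2 + (?P a' x)\<^sup>2 * (?P b x)\<^sup>2)
        + c * ((?P a' x)\<^sup>2 * (?P b' x)\<^sup>2))"
    unfolding expectation_cube_pmf_insert[OF ins less_imp_le[OF p(1)] less_imp_le[OF p(2)]]
      noisy_poly_insert[OF ins] a'_def b'_def c_def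
    using ins p by (intro integral_mono bernoulli_fourth_moment_bound) auto
  also have "\<dots> = Q a b + 4 * \<rho>\<^sup>2 * (Q a b' + Q a' b) + c * Q a' b'"
    unfolding Q_def using ins by simp
  also have "\<dots> \<le> R a b + (R a b' + R a' b) + c * R a' b'"
  proof (intro add_mono mult_left_mono QR c0)
    \<comment> \<open>The bound on \<rho> lowers the weight of the mixed pairs to 1, the weight they
      have when the product of upper weights below is expanded.\<close>
    have "4 * \<rho>\<^sup>2 * (Q a b' + Q a' b) \<le> Q a b' + Q a' b"
      using \<rho> Q0 by (intro mult_left_le_one_le add_nonneg_nonneg) auto
    also have "\<dots> \<le> R a b' + R a' b"
      by (intro add_mono QR)
    finally show "4 * \<rho>\<^sup>2 * (Q a b' + Q a' b) \<le> R a b' + R a' b" .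
  qed
  \<comment> \<open>The nonnegative \<open>R a' b'\<close> is added to complete the product of the
    sums \<open>?W a S + ?W a' S\<close> and \<open>?W b S + ?W b' S\<close>, which belongs to the
    sets avoiding \<open>i\<close>; \<open>c * R a' b'\<close> accounts for the sets containing
    \<open>i\<close>.\<close>
  also have "\<dots> \<le> R a b + (R a b' + R a' b) + R a' b' + c * R a' b'"
    using Q0[of a' b'] QR[of a' b'] by linarith
  also have "\<dots> = (\<Sum>S\<in>Pow I. c ^ card S * ((?W a S + ?W a' S) * (?W b S + ?W b' S)))
      + (\<Sum>S\<in>Pow I. c ^ Suc (card S) * (?W a' S * ?W b' S))"
    unfolding R_def sum_distrib_left sum.distrib[symmetric]
    by (intro sum.cong refl) (simp add: algebra_simps)
  also have "\<dots> = (\<Sum>S\<in>Pow (insert i I). c ^ card S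
      * (upper_weight (insert i I) a S * upper_weight (insert i I) b S))"
    unfolding sum_Pow_insert[OF ins]
    by (intro arg_cong2[of _ _ _ _ "(+)"] sum.cong refl)
       (simp_all add: upper_weight_insert[OF ins] card a'_def b'_def)
  finally show ?case
    unfolding c_def .
qed

section \<open>Parseval and norms of derivatives\<close>

text \<open>By independence the expectation is a product over coordinates: a coordinate in exactly
  one of the sets contributes the mean 0 of a character, every other one contributes 1.\<close>

lemma char_fun_orthonormal:
  assumes I: "finite I" "S \<subseteq> I" "T \<subseteq> I" and p: "0 < p" "p < 1"
  shows "measure_pmf.expectation (cube_pmf I p) (\<lambda>x. char_fun p S x * char_fun p T x)
    = of_bool (S = T)"
proof -
  let ?g = "\<lambda>i b. (if i \<in> S then bit_char p b else 1) * (if i \<in> T then bit_char p b else 1)"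
  have sd: "bias_sd p * bias_sd p = p * (1 - p)"
    using p by (simp add: bias_sd_def)
  have bit: "measure_pmf.expectation (bernoulli_pmf p) (?g i) = of_bool (i \<in> S \<longleftrightarrow> i \<in> T)" for i
    using p by (cases "i \<in> S"; cases "i \<in> T") (simp_all add: bit_char_def sd field_simps)
  have "measure_pmf.expectation (cube_pmf I p) (\<lambda>x. char_fun p S x * char_fun p T x)
      = measure_pmf.expectation (cube_pmf I p) (\<lambda>x. \<Prod>i\<in>I. ?g i (x i))"
    by (simp only: char_fun_extend[OF I(1) I(2)] char_fun_extend[OF I(1) I(3)] prod.distrib)
  also have "\<dots> = (\<Prod>i\<in>I. of_bool (i \<in> S \<longleftrightarrow> i \<in> T))"
    unfolding cube_pmf_def by (subst expectation_prod_Pi_pmf_bool[OF I(1)]) (simp only: bit)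
  also have "\<dots> = of_bool (\<forall>i\<in>I. i \<in> S \<longleftrightarrow> i \<in> T)"
    using I(1) by (induction I rule: finite_induct) auto
  also have "(\<forall>i\<in>I. i \<in> S \<longleftrightarrow> i \<in> T) \<longleftrightarrow> S = T"
    using I by auto
  finally show ?thesis .
qed

lemma Lnorm_power:
  assumes "0 < k"
  shows "Lnorm I p (real k) g ^ k = measure_pmf.expectation (cube_pmf I p) (\<lambda>x. \<bar>g x\<bar> ^ k)"
proof -
  let ?e = "measure_pmf.expectation (cube_pmf I p) (\<lambda>x. \<bar>g x\<bar> ^ k)"
  have e: "0 \<le> ?e"
    by (intro integral_nonneg_AE) auto
  \<comment> \<open>A zero value is treated separately because \<open>powr_realpow\<close> needs a
    positive base; there \<open>0 < k\<close> makes both sides 0.\<close>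
  have "\<bar>g x\<bar> powr real k = \<bar>g x\<bar> ^ k" for x
    using assms by (cases "g x = 0") (auto simp: powr_realpow)
  then have "Lnorm I p (real k) g ^ k = (?e powr (1 / real k)) ^ k"
    by (simp add: Lnorm_def)
  also have "\<dots> = ?e"
    using assms e by (cases "?e = 0") (simp_all add: powr_power)
  finally show ?thesis .
qed

text \<open>Removing \<open>S\<close> is injective on the supersets of \<open>S\<close>, so the
  characters occurring in the derivative are still orthonormal.\<close>

lemma Lnorm_deriv_op_squared:
  assumes I: "finite I" and p: "0 < p" "p < 1"
  shows "(Lnorm I p 2 (deriv_op I p S f))\<^sup>2 = upper_weight I (fourier_coeff I p f) S"
proof -
  let ?A = "{T. S \<subseteq> T \<and> T \<subseteq> I}"
  let ?a = "fourier_coeff I p f"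
  let ?E = "measure_pmf.expectation (cube_pmf I p)"
  have finA: "finite ?A"
    by (rule finite_subset[of _ "Pow I"]) (use I in auto)
  have "(Lnorm I p 2 (deriv_op I p S f))\<^sup>2 = ?E (\<lambda>x. (deriv_op I p S f x)\<^sup>2)"
    using Lnorm_power[of 2 I p "deriv_op I p S f"] by simp
  also have "\<dots> = ?E (\<lambda>x. \<Sum>T\<in>?A. \<Sum>U\<in>?A. ?a T * ?a U * (char_fun p (T - S) x * char_fun p (U - S) x))"
    by (simp add: deriv_op_def power2_eq_square sum_product mult_ac)
  also have "\<dots> = (\<Sum>T\<in>?A. \<Sum>U\<in>?A. ?a T * ?a U * ?E (\<lambda>x. char_fun p (T - S) x * char_fun p (U - S) x))"
    using I by (simp add: Bochner_Integration.integral_sum)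
  also have "\<dots> = (\<Sum>T\<in>?A. \<Sum>U\<in>?A. if U = T then (?a T)\<^sup>2 else 0)"
  proof (intro sum.cong refl)
    fix T U assume TU: "T \<in> ?A" "U \<in> ?A"
    then have "?E (\<lambda>x. char_fun p (T - S) x * char_fun p (U - S) x) = of_bool (T - S = U - S)"
      by (intro char_fun_orthonormal I p) auto
    moreover have "T - S = U - S \<longleftrightarrow> U = T"
      using TU by auto
    ultimately show "?a T * ?a U * ?E (\<lambda>x. char_fun p (T - S) x * char_fun p (U - S) x)
        = (if U = T then (?a T)\<^sup>2 else 0)"
      by (simp add: power2_eq_square)
  qed
  also have "\<dots> = upper_weight I ?a S"
    using finA by (simp add: upper_weight_def)
  finally show ?thesis .
qed

section \<open>Comparison with influences and conclusion\<close>

lemma fourth_moment_le: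
  assumes p: "0 < p" "p < 1"
  shows "fourth_moment p \<le> 1 / (bias_sd p)\<^sup>2"
proof -
  have "(1 - p) ^ 3 + p ^ 3 = 1 - 3 * (p * (1 - p))"
    by algebra
  also have "\<dots> \<le> 1"
    using p by simp
  finally show ?thesis
    unfolding fourth_moment_eq[OF p] by (intro divide_right_mono) auto
qed

theorem theorem3p4:
  fixes n :: nat and p \<rho> :: real and f :: "(nat \<Rightarrow> bool) \<Rightarrow> real"
  assumes "0 < p" and "p < 1"
    and "0 \<le> \<rho>" and "\<rho> \<le> 1 / sqrt 12"
  shows "Lnorm {1..n} p 4 (noise_op {1..n} p \<rho> f) ^ 4
           \<le> (\<Sum>S\<in>Pow {1..n}. (3 * fourth_moment p * \<rho> ^ 4) ^ card S
                * Lnorm {1..n} p 2 (deriv_op {1..n} p S f) ^ 4)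
       \<and> (\<Sum>S\<in>Pow {1..n}. (3 * fourth_moment p * \<rho> ^ 4) ^ card S
                * Lnorm {1..n} p 2 (deriv_op {1..n} p S f) ^ 4)
           \<le> (\<Sum>S\<in>Pow {1..n}. (3 * (bias_sd p)\<^sup>2 * \<rho> ^ 4) ^ card S
                * (gen_influence {1..n} p S f)\<^sup>2)"
proof (intro conjI sum_mono)
  let ?I = "{1..n}"
  note p = assms(1,2)
  let ?a = "fourier_coeff ?I p f"
  let ?N = "\<lambda>S. Lnorm ?I p 2 (deriv_op ?I p S f)"
  have "\<rho>\<^sup>2 \<le> (1 / sqrt 12)\<^sup>2"
    using assms(3,4) by (intro power_mono)
  then have \<rho>: "4 * \<rho>\<^sup>2 \<le> 1"
    by (simp add: power_divide)
  have sq_sq: "z ^ 4 = z\<^sup>2 * z\<^sup>2" for z :: real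
    by algebra
  \<comment> \<open>The two-function bound is applied with both families equal to the Fourier
    coefficients of \<open>f\<close>.\<close>
  have "Lnorm ?I p 4 (noise_op ?I p \<rho> f) ^ 4
      = measure_pmf.expectation (cube_pmf ?I p)
          (\<lambda>x. (noisy_poly ?I p \<rho> ?a x)\<^sup>2 * (noisy_poly ?I p \<rho> ?a x)\<^sup>2)"
    using Lnorm_power[of 4 ?I p "noise_op ?I p \<rho> f"]
    by (simp add: noise_op_def noisy_poly_def flip: sq_sq)
  also have "\<dots> \<le> (\<Sum>S\<in>Pow ?I. (3 * fourth_moment p * \<rho> ^ 4) ^ card S
      * (upper_weight ?I ?a S * upper_weight ?I ?a S))"
    by (intro noisy_poly_product_bound p \<rho>) simp
  also have "\<dots> = (\<Sum>S\<in>Pow ?I. (3 * fourth_moment p * \<rho> ^ 4) ^ card S * ?N S ^ 4)"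
    unfolding sq_sq Lnorm_deriv_op_squared[OF finite_atLeastAtMost p] ..
  finally show "Lnorm ?I p 4 (noise_op ?I p \<rho> f) ^ 4
      \<le> (\<Sum>S\<in>Pow ?I. (3 * fourth_moment p * \<rho> ^ 4) ^ card S * ?N S ^ 4)" .
  fix S :: "nat set"
  define s where "s = (bias_sd p)\<^sup>2"
  have s: "0 < s"
    using p by (simp add: s_def bias_sd_def)
  have "0 \<le> fourth_moment p"
    by (simp add: fourth_moment_def integral_nonneg_AE)
  then have "(3 * fourth_moment p * \<rho> ^ 4) ^ card S * ?N S ^ 4
      \<le> (3 * (1 / s) * \<rho> ^ 4) ^ card S * ?N S ^ 4"
    using fourth_moment_le[OF p] unfolding s_def
    by (intro mult_right_mono power_mono mult_left_mono mult_nonneg_nonneg) auto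
  \<comment> \<open>The squared influence carries \<open>s\<close> to the power
    \<open>- 2 * card S\<close>, which turns \<open>1 / s\<close> in the weight into
    \<open>s\<close>.\<close>
  also have "\<dots> = (3 * s * \<rho> ^ 4) ^ card S * ((?N S)\<^sup>2 / s ^ card S)\<^sup>2"
    using s by (simp add: power_divide power_mult_distrib field_simps) (simp add: power_mult power2_eq_square)
  also have "\<dots> = (3 * (bias_sd p)\<^sup>2 * \<rho> ^ 4) ^ card S * (gen_influence ?I p S f)\<^sup>2"
    by (simp add: gen_influence_def s_def power_mult)
  finally show "(3 * fourth_moment p * \<rho> ^ 4) ^ card S * ?N S ^ 4
      \<le> (3 * (bias_sd p)\<^sup>2 * \<rho> ^ 4) ^ card S * (gen_influence ?I p S f)\<^sup>2" .
qed

end
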